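(* Let $(X,d)$ be a compact metric space, let $\mathbb{I}=\{S_1,\dots,S_N\}$ be an iterated function system of similarities on $X$ with similarity dimension $s$, and let $C\subseteq X$ be a non-empty compact set with $\max\{s,\underline{\dim}_{\mathrm B}C\}<\overline{\dim}_{\mathrm B}C$. Let $F_\emptyset$ be the homogeneous attractor of $\mathbb{I}$ and $F_C$ the inhomogeneous attractor of $\mathbb{I}$ with condensation $C$. Then for all $t>\max\{s,\underline{\dim}_{\mathrm B}C\}$, $$\underline{\dim}_{\mathrm B}F_C\ \le\ \max\{t,\ s+p_t(C)\,t\}.$$ In particular, if $p_t(C)=0$ for all $t>\max\{s,\underline{\dim}_{\mathrm B}C\}$, then $$\underline{\dim}_{\mathrm B}F_C\ \le\ \max\{s,\ \underline{\dim}_{\mathrm B}C\},$$ and if, furthermore, $\mathbb{I}$ satisfies the strong open set condition (SOSC), then $$\underline{\dim}_{\mathrm B}F_C=\max\{\underline{\dim}_{\mathrm B}F_\emptyset,\ \underline{\dim}_{\mathrm B}C\}.$$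
   Context: An iterated function system (IFS) of similarities on $X$ is a finite collection of maps $S_i:X\to X$ such that for each $i$ there is a constant $\mathrm{Lip}(S_i)\in(0,1)$ with $d(S_i(x),S_i(y))=\mathrm{Lip}(S_i)\,d(x,y)$ for all $x,y\in X$. The homogeneous attractor $F_\emptyset$ is the unique non-empty compact set with $F_\emptyset=\bigcup_{i=1}^N S_i(F_\emptyset)$. The inhomogeneous attractor $F_C$ is the unique non-empty compact set with $F_C=\bigcup_{i=1}^N S_i(F_C)\cup C$. The similarity dimension $s$ is the unique solution of $\sum_{i=1}^N \mathrm{Lip}(S_i)^s=1$. The IFS satisfies the SOSC if there is a non-empty open set $U\subseteq X$ with $F_\emptyset\cap U\neq\emptyset$ and $\bigcup_{i=1}^N S_i(U)\subseteq U$ with the union disjoint. For a non-empty set $E\subseteq X$ and $\delta>0$, $N_\delta(E)$ is the minimum number of sets of diameter at most $\delta$ required to cover $E$; $\underline{\dim}_{\mathrm B}E$ and $\overline{\dim}_{\mathrm B}E$ are the $\liminf$ and $\limsup$, respectively, of $\frac{\log N_\delta(E)}{-\log\delta}$ as $\delta\to0$. Covering regularity exponents: for $t\ge0$ and $\delta\in(0,1]$, $p_{t,\delta}(C)=\sup\{p\in[0,1]:N_{\delta^p}(C)\ge\delta^{-pt}\}$, and $p_t(C)=\liminf_{\delta\to0}p_{t,\delta}(C)$. *)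

theory Defs
  imports "HOL-Analysis.Analysis"
begin

text \<open>The ambient metric space $X$ is the whole type; its compactness is a hypothesis
  of the theorem.\<close>

definition similarity_with :: "real \<Rightarrow> ('a::metric_space \<Rightarrow> 'a) \<Rightarrow> bool" where
  "similarity_with c f \<longleftrightarrow> 0 < c \<and> c < 1 \<and> (\<forall>x y. dist (f x) (f y) = c * dist x y)"

definition similarity_ifs :: "nat \<Rightarrow> (nat \<Rightarrow> 'a::metric_space \<Rightarrow> 'a) \<Rightarrow> bool" where
  "similarity_ifs N S \<longleftrightarrow> 1 \<le> N \<and> (\<forall>i\<in>{1..N}. \<exists>c. similarity_with c (S i))"

text \<open>The ratio is unique as soon as the space has two points; on a one-point space
  every number in $(0,1)$ is a ratio, hence a choice operator.\<close>

definition Lip :: "('a::metric_space \<Rightarrow> 'a) \<Rightarrow> real" where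
  "Lip f = (SOME c. similarity_with c f)"

definition is_similarity_dimension :: "nat \<Rightarrow> (nat \<Rightarrow> 'a::metric_space \<Rightarrow> 'a) \<Rightarrow> real \<Rightarrow> bool" where
  "is_similarity_dimension N S s \<longleftrightarrow> (\<Sum>i=1..N. Lip (S i) powr s) = 1"

text \<open>The attractor with condensation set \<open>C\<close>; the homogeneous attractor is the case
  \<open>C = {}\<close>.\<close>

definition is_attractor ::
  "nat \<Rightarrow> (nat \<Rightarrow> 'a::metric_space \<Rightarrow> 'a) \<Rightarrow> 'a set \<Rightarrow> 'a set \<Rightarrow> bool" where
  "is_attractor N S C F \<longleftrightarrow> F \<noteq> {} \<and> compact F \<and> F = (\<Union>i\<in>{1..N}. S i ` F) \<union> C"

text \<open>The strong open set condition, where \<open>F\<close> is the homogeneous attractor.\<close>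

definition SOSC :: "nat \<Rightarrow> (nat \<Rightarrow> 'a::metric_space \<Rightarrow> 'a) \<Rightarrow> 'a set \<Rightarrow> bool" where
  "SOSC N S F \<longleftrightarrow> (\<exists>U. U \<noteq> {} \<and> open U \<and> F \<inter> U \<noteq> {} \<and>
     (\<Union>i\<in>{1..N}. S i ` U) \<subseteq> U \<and> disjoint_family_on (\<lambda>i. S i ` U) {1..N})"

text \<open>Boundedness is required explicitly because \<open>diameter\<close> has no meaningful value on
  unbounded sets.\<close>

definition covering_number :: "real \<Rightarrow> 'a::metric_space set \<Rightarrow> nat" where
  "covering_number \<delta> E = (LEAST n. \<exists>\<U>. finite \<U> \<and> card \<U> = n \<and> E \<subseteq> \<Union>\<U> \<and>
     (\<forall>U\<in>\<U>. bounded U \<and> diameter U \<le> \<delta>))"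

text \<open>Box dimensions take values in the extended reals: a compact metric space may have
  infinite box dimension.\<close>

definition lower_box_dim :: "'a::metric_space set \<Rightarrow> ereal" where
  "lower_box_dim E =
     Liminf (at_right 0) (\<lambda>\<delta>. ereal (ln (real (covering_number \<delta> E)) / (- ln \<delta>)))"

definition upper_box_dim :: "'a::metric_space set \<Rightarrow> ereal" where
  "upper_box_dim E =
     Limsup (at_right 0) (\<lambda>\<delta>. ereal (ln (real (covering_number \<delta> E)) / (- ln \<delta>)))"

definition cov_reg_exp_at :: "real \<Rightarrow> real \<Rightarrow> 'a::metric_space set \<Rightarrow> real" where
  "cov_reg_exp_at t \<delta> C =
     Sup {p \<in> {0..1}. real (covering_number (\<delta> powr p) C) \<ge> \<delta> powr (- (p * t))}"

definition cov_reg_exp :: "real \<Rightarrow> 'a::metric_space set \<Rightarrow> ereal" where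
  "cov_reg_exp t C = Liminf (at_right 0) (\<lambda>\<delta>. ereal (cov_reg_exp_at t \<delta> C))"

end

theory Submission
  imports Defs
begin

text \<open>
  Both bounds for lower box dimensions come from functional inequalities between covering numbers
  at different scales. Write $c_i$ for the ratios, $N_r(E)$ for the covering numbers, $F_C$ for
  the attractor with condensation $C$ and $s$ for the similarity dimension. A similarity of ratio
  $c$ satisfies $N_r(S(E)) = N_{r/c}(E)$.

  \<^emph>\<open>Upper bound.\<close> Since $F_C$ is the union of its images $S_i(F_C)$ and $C$,
  \[ N_r(F_C) \le N_r(C) + \sum_i N_{r/c_i}(F_C). \]
  Fix a scale $\delta$ and suppose that $N_r(C) \le r^{-t} + M$ for $\delta \le r \le 1$.
  For $t, u > s$ the sums $\sum_i c_i^t$ and $\sum_i c_i^u$ are less than $1$. This slack makes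
  $A (r^{-t} + M r^{-u})$ a supersolution of the recursion for a constant $A$ that depends on
  neither $\delta$ nor $M$, so it bounds $N_r(F_C)$ down to $r = \delta$
  (\<open>covering_number_attractor_le\<close>). If the covering regularity exponent of $C$ at $\delta$ is
  less than $q$, then $N_r(C) < r^{-t}$ for $\delta \le r \le \delta^q$, and at the coarser
  scales $N_r(C) \le N_{\delta^q}(C) < \delta^{-qt}$. Thus $M = \delta^{-qt}$ is
  admissible and $N_\delta(F_C)$ is at most a constant times
  $\delta^{-t} + \delta^{-(u + qt)}$. There are arbitrarily small such $\delta$ for every
  $q$ above $p_t(C)$; letting $q$ decrease to $p_t(C)$ and $u$ to $s$ gives
  $\max\{t, s + p_t(C) t\}$. When $p_t(C) = 1$ no such $q \le 1$ exists, and the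
  inequality $N_\delta(C) < \delta^{-t}$, which recurs because $t$ exceeds the lower box
  dimension of $C$, takes its place.

  \<^emph>\<open>Lower bound under the strong open set condition.\<close> The open set $U$ contains a whole cylinder
  $S_w(F_\emptyset)$, so the sets $S_v(S_w(F_\emptyset))$, with $v$ ranging over the words
  of length $n$, lie in the disjoint sets $S_v(U)$. They are disjoint compact subsets of
  $F_\emptyset$, hence separated by some $\eta > 0$, and for $r < \eta$ the reverse recursion
  $N_r(F_\emptyset) \ge \sum_v N_{r/(c_v c_w)}(F_\emptyset)$ holds. For
  $0 \le \sigma < s$ and $n$ large, $\sum_v (c_v c_w)^\sigma = c_w^\sigma
  (\sum_i c_i^\sigma)^n \ge 1$, so a multiple of $r^{-\sigma}$ is a subsolution and
  the lower box dimension of $F_\emptyset$ is at least $\sigma$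
  (\<open>SOSC_lower_box_dim_ge\<close>). The final equality follows by monotonicity, because $F_C$ contains
  both $F_\emptyset$ and $C$.
\<close>

section \<open>Covering numbers\<close>

definition small_cover :: "real \<Rightarrow> 'a::metric_space set \<Rightarrow> 'a set set \<Rightarrow> bool" where
  "small_cover \<delta> E \<U> \<longleftrightarrow> finite \<U> \<and> E \<subseteq> \<Union>\<U> \<and> (\<forall>U\<in>\<U>. bounded U \<and> diameter U \<le> \<delta>)"

lemma covering_number_le_card:
  assumes "small_cover \<delta> E \<U>"
  shows "covering_number \<delta> E \<le> card \<U>"
  using assms unfolding covering_number_def small_cover_def by (intro Least_le) blast

lemma diameter_le_of_dist_le:
  fixes U :: "'a::metric_space set"
  assumes "0 \<le> d" and "\<And>x y. \<lbrakk>x \<in> U; y \<in> U\<rbrakk> \<Longrightarrow> dist x y \<le> d"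
  shows "diameter U \<le> d"
  using assms unfolding diameter_def by (auto intro!: cSUP_least)

lemma optimal_cover_exists:
  fixes E :: "'a::metric_space set"
  assumes "compact (UNIV :: 'a set)" and "0 < \<delta>"
  obtains \<U> where "small_cover \<delta> E \<U>" and "card \<U> = covering_number \<delta> E"
proof -
  let ?B = "\<lambda>x::'a. ball x (\<delta> / 2)"
  have "(UNIV :: 'a set) \<subseteq> (\<Union>x\<in>UNIV. ?B x)"
  proof
    fix x :: 'a
    have "x \<in> ?B x" using assms(2) by simp
    then show "x \<in> (\<Union>x. ?B x)" by blast
  qed
  then obtain K where K: "finite K" "(UNIV :: 'a set) \<subseteq> (\<Union>x\<in>K. ?B x)"
    using compactE_image[OF assms(1), of UNIV ?B] by auto
  have diam: "diameter (?B x) \<le> \<delta>" for x :: 'a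
  proof (rule diameter_le_of_dist_le)
    show "0 \<le> \<delta>" using assms(2) by simp
    fix y z assume "y \<in> ?B x" "z \<in> ?B x"
    then show "dist y z \<le> \<delta>"
      using dist_triangle3[of y z x] by auto
  qed
  have "\<exists>n \<U>. finite \<U> \<and> card \<U> = n \<and> E \<subseteq> \<Union>\<U> \<and> (\<forall>U\<in>\<U>. bounded U \<and> diameter U \<le> \<delta>)"
    using K diam by (intro exI[of _ "card (?B ` K)"] exI[of _ "?B ` K"]) auto
  from LeastI_ex[OF this] show thesis
    using that unfolding covering_number_def small_cover_def by blast
qed

lemma covering_number_subset:
  fixes E :: "'a::metric_space set"
  assumes "compact (UNIV :: 'a set)" and "0 < \<delta>" and "E \<subseteq> E'"
  shows "covering_number \<delta> E \<le> covering_number \<delta> E'"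
proof -
  obtain \<U> where "small_cover \<delta> E' \<U>" "card \<U> = covering_number \<delta> E'"
    using optimal_cover_exists assms by blast
  then show ?thesis
    using assms(3) covering_number_le_card[of \<delta> E \<U>] by (auto simp: small_cover_def)
qed

lemma covering_number_antimono:
  fixes E :: "'a::metric_space set"
  assumes "compact (UNIV :: 'a set)" and "0 < \<delta>" and "\<delta> \<le> \<delta>'"
  shows "covering_number \<delta>' E \<le> covering_number \<delta> E"
proof -
  obtain \<U> where "small_cover \<delta> E \<U>" "card \<U> = covering_number \<delta> E"
    using optimal_cover_exists assms by blast
  then show ?thesis
    using assms(3) covering_number_le_card[of \<delta>' E \<U>] by (fastforce simp: small_cover_def)
qed

lemma covering_number_ge_1:
  fixes E :: "'a::metric_space set"
  assumes "compact (UNIV :: 'a set)" and "0 < \<delta>" and "E \<noteq> {}"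
  shows "1 \<le> covering_number \<delta> E"
proof -
  obtain \<U> where "small_cover \<delta> E \<U>" "card \<U> = covering_number \<delta> E"
    using optimal_cover_exists assms by blast
  then show ?thesis
    using assms(3) by (cases "\<U> = {}") (auto simp: small_cover_def Suc_le_eq card_gt_0_iff)
qed

lemma covering_number_Un:
  fixes E :: "'a::metric_space set"
  assumes "compact (UNIV :: 'a set)" and "0 < \<delta>"
  shows "covering_number \<delta> (E \<union> E') \<le> covering_number \<delta> E + covering_number \<delta> E'"
proof -
  obtain \<U> where \<U>: "small_cover \<delta> E \<U>" "card \<U> = covering_number \<delta> E"
    using optimal_cover_exists assms by blast
  obtain \<V> where \<V>: "small_cover \<delta> E' \<V>" "card \<V> = covering_number \<delta> E'"
    using optimal_cover_exists assms by blast
  have "small_cover \<delta> (E \<union> E') (\<U> \<union> \<V>)"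
    using \<U>(1) \<V>(1) unfolding small_cover_def by auto
  then show ?thesis
    using covering_number_le_card[of \<delta> "E \<union> E'" "\<U> \<union> \<V>"] card_Un_le[of \<U> \<V>] \<U>(2) \<V>(2) by linarith
qed

lemma covering_number_UN:
  fixes E :: "'i \<Rightarrow> 'a::metric_space set"
  assumes "compact (UNIV :: 'a set)" and "0 < \<delta>" and "finite I"
  shows "covering_number \<delta> (\<Union>i\<in>I. E i) \<le> (\<Sum>i\<in>I. covering_number \<delta> (E i))"
  using assms(3)
proof (induction I rule: finite_induct)
  case empty
  have "small_cover \<delta> ({} :: 'a set) {}" by (simp add: small_cover_def)
  then show ?case using covering_number_le_card by fastforce
next
  case (insert i I)
  then show ?case
    using covering_number_Un[OF assms(1,2), of "E i" "\<Union>i\<in>I. E i"] by simp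
qed

lemma diameter_image_similarity_le:
  assumes "\<And>x y. dist (f x) (f y) = c * dist x y" and "0 \<le> c" and "bounded U"
  shows "diameter (f ` U) \<le> c * diameter U"
proof (rule diameter_le_of_dist_le)
  show "0 \<le> c * diameter U"
    using assms(2) diameter_ge_0[OF assms(3)] by simp
  fix x y assume "x \<in> f ` U" "y \<in> f ` U"
  then obtain x' y' where "x' \<in> U" "y' \<in> U" "x = f x'" "y = f y'" by blast
  then show "dist x y \<le> c * diameter U"
    using assms diameter_bounded_bound[OF assms(3)] by (auto intro!: mult_left_mono)
qed

text \<open>Covers move in both directions: take images of the covering sets under the similarity, or
  preimages, which need not lie inside the covered set.\<close>

lemma covering_number_similarity_image:
  fixes E :: "'a::metric_space set" and f :: "'a \<Rightarrow> 'a"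
  assumes X: "compact (UNIV :: 'a set)" and "0 < \<delta>" and "0 < c"
    and f: "\<And>x y. dist (f x) (f y) = c * dist x y"
  shows "covering_number \<delta> (f ` E) = covering_number (\<delta> / c) E"
proof (rule antisym)
  have bdd: "bounded U" for U :: "'a set"
    using compact_imp_bounded[OF X] bounded_subset by blast
  have \<delta>c: "0 < \<delta> / c" using assms by simp
  obtain \<U> where \<U>: "small_cover (\<delta> / c) E \<U>" "card \<U> = covering_number (\<delta> / c) E"
    using optimal_cover_exists[OF X \<delta>c] by blast
  have "diameter (f ` U) \<le> \<delta>" if "U \<in> \<U>" for U
  proof -
    have "diameter (f ` U) \<le> c * diameter U"
      using f \<open>0 < c\<close> bdd by (intro diameter_image_similarity_le) auto
    also have "\<dots> \<le> c * (\<delta> / c)"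
      using that \<U>(1) \<open>0 < c\<close> unfolding small_cover_def by (intro mult_left_mono) auto
    finally show ?thesis using \<open>0 < c\<close> by simp
  qed
  then have "small_cover \<delta> (f ` E) ((`) f ` \<U>)"
    using \<U>(1) bdd unfolding small_cover_def by blast
  then have "covering_number \<delta> (f ` E) \<le> card ((`) f ` \<U>)"
    by (rule covering_number_le_card)
  also have "\<dots> \<le> card \<U>" using \<U>(1) by (intro card_image_le) (simp add: small_cover_def)
  finally show "covering_number \<delta> (f ` E) \<le> covering_number (\<delta> / c) E" using \<U>(2) by simp
next
  have bdd: "bounded U" for U :: "'a set"
    using compact_imp_bounded[OF X] bounded_subset by blast
  obtain \<U> where \<U>: "small_cover \<delta> (f ` E) \<U>" "card \<U> = covering_number \<delta> (f ` E)"
    using optimal_cover_exists[OF X \<open>0 < \<delta>\<close>] by blast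
  have "diameter (f -` U) \<le> \<delta> / c" if "U \<in> \<U>" for U
  proof (rule diameter_le_of_dist_le)
    show "0 \<le> \<delta> / c" using assms by simp
    fix x y assume "x \<in> f -` U" "y \<in> f -` U"
    then have "dist (f x) (f y) \<le> diameter U"
      by (intro diameter_bounded_bound[OF bdd]) auto
    then have "c * dist x y \<le> \<delta>"
      using f that \<U>(1) unfolding small_cover_def by fastforce
    then show "dist x y \<le> \<delta> / c" using \<open>0 < c\<close> by (simp add: field_simps)
  qed
  then have "small_cover (\<delta> / c) E ((-`) f ` \<U>)"
    using \<U>(1) bdd unfolding small_cover_def by (auto simp: subset_eq)
  then have "covering_number (\<delta> / c) E \<le> card ((-`) f ` \<U>)"
    by (rule covering_number_le_card)
  also have "\<dots> \<le> card \<U>" using \<U>(1) by (intro card_image_le) (simp add: small_cover_def)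
  finally show "covering_number (\<delta> / c) E \<le> covering_number \<delta> (f ` E)" using \<U>(2) by simp
qed

text \<open>A set whose diameter is below the mutual distance of the pieces meets at most one of them,
  so an optimal cover of a set containing the pieces splits into disjoint covers of them.\<close>

lemma sum_covering_number_separated_le:
  fixes E :: "'a::metric_space set"
  assumes X: "compact (UNIV :: 'a set)" and "0 < r" and "finite J"
    and sub: "\<And>j. j \<in> J \<Longrightarrow> A j \<subseteq> E"
    and sep: "\<And>i j x y. \<lbrakk>i \<in> J; j \<in> J; i \<noteq> j; x \<in> A i; y \<in> A j\<rbrakk> \<Longrightarrow> r < dist x y"
  shows "(\<Sum>j\<in>J. covering_number r (A j)) \<le> covering_number r E"
proof -
  obtain \<U> where \<U>: "small_cover r E \<U>" "card \<U> = covering_number r E"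
    using optimal_cover_exists[OF X \<open>0 < r\<close>] by blast
  define \<V> where "\<V> j = {U \<in> \<U>. U \<inter> A j \<noteq> {}}" for j
  have fin: "finite (\<V> j)" for j
    using \<U>(1) by (simp add: \<V>_def small_cover_def)
  have cover: "small_cover r (A j) (\<V> j)" if "j \<in> J" for j
    using \<U>(1) sub[OF that] fin unfolding small_cover_def \<V>_def by fastforce
  have disj: "\<V> i \<inter> \<V> j = {}" if ij: "i \<in> J" "j \<in> J" "i \<noteq> j" for i j
  proof (rule ccontr)
    assume "\<V> i \<inter> \<V> j \<noteq> {}"
    then obtain U x y where "U \<in> \<U>" "x \<in> U" "x \<in> A i" "y \<in> U" "y \<in> A j"
      unfolding \<V>_def by blast
    moreover from this have "dist x y \<le> r"
      using \<U>(1) diameter_bounded_bound[of U x y] unfolding small_cover_def by force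
    ultimately show False using sep[OF ij, of x y] by simp
  qed
  have "(\<Sum>j\<in>J. covering_number r (A j)) \<le> (\<Sum>j\<in>J. card (\<V> j))"
    using cover by (intro sum_mono covering_number_le_card)
  also have "\<dots> = card (\<Union>j\<in>J. \<V> j)"
    using \<open>finite J\<close> fin disj by (intro card_UN_disjoint[symmetric]) auto
  also have "\<dots> \<le> card \<U>"
    using \<U>(1) by (intro card_mono) (auto simp: \<V>_def small_cover_def)
  finally show ?thesis using \<U>(2) by simp
qed

section \<open>Lower box dimension\<close>

lemma lower_box_dim_mono:
  fixes E :: "'a::metric_space set"
  assumes "compact (UNIV :: 'a set)" and "E \<noteq> {}" and "E \<subseteq> E'"
  shows "lower_box_dim E \<le> lower_box_dim E'"
  unfolding lower_box_dim_def
proof (rule Liminf_mono)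
  have "eventually (\<lambda>\<delta>::real. 0 < \<delta> \<and> \<delta> < 1) (at_right 0)"
    unfolding eventually_at_right_field by (intro exI[of _ 1]) auto
  then show "eventually (\<lambda>\<delta>. ereal (ln (real (covering_number \<delta> E)) / - ln \<delta>)
      \<le> ereal (ln (real (covering_number \<delta> E')) / - ln \<delta>)) (at_right 0)"
  proof eventually_elim
    case (elim \<delta>)
    then have "1 \<le> covering_number \<delta> E" "covering_number \<delta> E \<le> covering_number \<delta> E'"
      using covering_number_ge_1[OF assms(1) _ assms(2)] covering_number_subset[OF assms(1) _ assms(3)]
      by auto
    then have "ln (real (covering_number \<delta> E)) \<le> ln (real (covering_number \<delta> E'))"
      by simp
    then show ?case using elim by (auto intro!: divide_right_mono_neg simp: divide_le_cancel)
  qed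
qed

lemma frequently_less_of_Liminf_less:
  fixes f :: "'a \<Rightarrow> ereal"
  assumes "Liminf F f < q"
  shows "frequently (\<lambda>x. f x < q) F"
proof (rule ccontr)
  assume "\<not> ?thesis"
  then have "eventually (\<lambda>x. q \<le> f x) F" by (simp add: frequently_def not_less)
  then have "q \<le> Liminf F f" by (rule Liminf_bounded)
  with assms show False by simp
qed

lemma frequently_covering_number_less:
  fixes E :: "'a::metric_space set"
  assumes X: "compact (UNIV :: 'a set)" and "E \<noteq> {}" and "lower_box_dim E < ereal t"
  shows "frequently (\<lambda>\<delta>. 0 < \<delta> \<and> \<delta> < 1 \<and> covering_number \<delta> E < \<delta> powr (- t)) (at_right 0)"
proof -
  have ev: "eventually (\<lambda>\<delta>::real. 0 < \<delta> \<and> \<delta> < 1) (at_right 0)"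
    unfolding eventually_at_right_field by (intro exI[of _ 1]) auto
  have "frequently (\<lambda>\<delta>. ereal (ln (real (covering_number \<delta> E)) / - ln \<delta>) < ereal t) (at_right 0)"
    using assms(3) unfolding lower_box_dim_def by (rule frequently_less_of_Liminf_less)
  from frequently_eventually_frequently[OF this ev] show ?thesis
  proof (rule frequently_elim1)
    fix \<delta> :: real
    assume *: "ereal (ln (real (covering_number \<delta> E)) / - ln \<delta>) < ereal t \<and> 0 < \<delta> \<and> \<delta> < 1"
    then have "1 \<le> covering_number \<delta> E"
      using covering_number_ge_1[OF X] assms(2) by blast
    moreover have "ln (real (covering_number \<delta> E)) < - t * ln \<delta>"
      using * pos_divide_less_eq[of "- ln \<delta>" _ t] by simp
    ultimately have "real (covering_number \<delta> E) < exp (- t * ln \<delta>)"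
      by (metis exp_less_cancel_iff exp_ln of_nat_0_less_iff zero_less_one order_less_le_trans)
    then show "0 < \<delta> \<and> \<delta> < 1 \<and> covering_number \<delta> E < \<delta> powr (- t)"
      using * by (simp add: powr_def)
  qed
qed

text \<open>One sequence of good scales suffices, and a constant factor disappears in the limit because
  its logarithm is divided by $-\log\delta$.\<close>

lemma lower_box_dim_le_of_frequently:
  fixes E :: "'a::metric_space set"
  assumes X: "compact (UNIV :: 'a set)" and "E \<noteq> {}" and "0 < A"
    and freq: "frequently (\<lambda>\<delta>. covering_number \<delta> E \<le> A * \<delta> powr (- v)) (at_right 0)"
  shows "lower_box_dim E \<le> ereal v"
proof (rule ccontr)
  assume "\<not> ?thesis"
  then obtain w where w: "v < w" "ereal w < lower_box_dim E"
    using ereal_dense2[of "ereal v" "lower_box_dim E"] by (auto simp: not_le)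
  have ev: "eventually (\<lambda>\<delta>. ereal w < ereal (ln (real (covering_number \<delta> E)) / - ln \<delta>)) (at_right 0)"
    using w(2) unfolding lower_box_dim_def by (rule less_LiminfD)
  have ev': "eventually (\<lambda>\<delta>::real. 0 < \<delta> \<and> \<delta> < 1 \<and> \<delta> < exp (- ln A / (w - v))) (at_right 0)"
    unfolding eventually_at_right_field
    by (intro exI[of _ "min 1 (exp (- ln A / (w - v)))"]) auto
  obtain \<delta> where \<delta>: "covering_number \<delta> E \<le> A * \<delta> powr (- v)"
      "w < ln (real (covering_number \<delta> E)) / - ln \<delta>" "0 < \<delta>" "\<delta> < 1"
      "\<delta> < exp (- ln A / (w - v))"
    using frequently_ex[OF frequently_eventually_frequently[OF freq eventually_conj[OF ev ev']]]
    by auto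
  have "1 \<le> covering_number \<delta> E"
    using covering_number_ge_1[OF X] assms(2) \<delta> by blast
  then have "ln (real (covering_number \<delta> E)) \<le> ln (A * \<delta> powr (- v))"
    using \<delta>(1) by (intro ln_mono) auto
  also have "\<dots> = ln A - v * ln \<delta>"
    using \<open>0 < A\<close> \<delta> by (simp add: ln_mult ln_powr)
  finally have "ln (real (covering_number \<delta> E)) \<le> ln A - v * ln \<delta>" .
  moreover have "ln \<delta> < - ln A / (w - v)"
    using \<delta>(3,5) by (metis ln_exp ln_less_cancel_iff exp_gt_zero)
  then have "(w - v) * ln \<delta> < - ln A"
    using w(1) by (simp add: field_simps)
  moreover have "- w * ln \<delta> < ln (real (covering_number \<delta> E))"
    using \<delta>(2-4) by (simp add: field_simps)
  ultimately show False by (simp add: algebra_simps)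
qed

lemma lower_box_dim_ge_of_powr_bound:
  fixes E :: "'a::metric_space set"
  assumes X: "compact (UNIV :: 'a set)" and "E \<noteq> {}" and "0 < a"
    and le: "\<And>r. 0 < r \<Longrightarrow> a * r powr (- \<sigma>) \<le> covering_number r E"
  shows "ereal \<sigma> \<le> lower_box_dim E"
proof (rule ccontr)
  assume "\<not> ?thesis"
  then obtain w where w: "w < \<sigma>" "lower_box_dim E < ereal w"
    using ereal_dense2[of "lower_box_dim E" "ereal \<sigma>"] by (auto simp: not_le)
  have ev: "eventually (\<lambda>\<delta>::real. \<delta> < exp (ln a / (\<sigma> - w))) (at_right 0)"
    unfolding eventually_at_right_field
    by (intro exI[of _ "exp (ln a / (\<sigma> - w))"]) auto
  obtain \<delta> where \<delta>: "0 < \<delta>" "covering_number \<delta> E < \<delta> powr (- w)" "\<delta> < exp (ln a / (\<sigma> - w))"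
    using frequently_ex[OF frequently_eventually_frequently[OF
          frequently_covering_number_less[OF X assms(2) w(2)] ev]] by auto
  have "a * \<delta> powr (- \<sigma>) < \<delta> powr (- w)" using le[OF \<delta>(1)] \<delta>(2) by linarith
  then have "ln (a * \<delta> powr (- \<sigma>)) < ln (\<delta> powr (- w))"
    using \<open>0 < a\<close> \<delta>(1) by (subst ln_less_cancel_iff) auto
  then have "ln a - \<sigma> * ln \<delta> < - w * ln \<delta>"
    using \<open>0 < a\<close> \<delta>(1) by (simp add: ln_mult ln_powr)
  moreover have "ln \<delta> < ln a / (\<sigma> - w)"
    using \<delta>(1,3) by (metis ln_exp ln_less_cancel_iff exp_gt_zero)
  then have "(\<sigma> - w) * ln \<delta> < ln a" using w(1) by (simp add: field_simps)
  ultimately show False by (simp add: algebra_simps)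
qed


section \<open>Similarities and words\<close>

lemma similarity_ifsD:
  assumes "similarity_ifs N S" and "i \<in> {1..N}"
  shows "0 < Lip (S i)" and "Lip (S i) < 1"
    and "dist (S i x) (S i y) = Lip (S i) * dist x y"
proof -
  have "similarity_with (Lip (S i)) (S i)"
    using assms someI_ex[of "\<lambda>c. similarity_with c (S i)"]
    unfolding similarity_ifs_def Lip_def by blast
  then show "0 < Lip (S i)" "Lip (S i) < 1" "dist (S i x) (S i y) = Lip (S i) * dist x y"
    unfolding similarity_with_def by auto
qed

lemma sum_ratio_powr_strict_antimono:
  fixes c :: "'i \<Rightarrow> real"
  assumes "finite I" and "I \<noteq> {}" and "\<And>i. i \<in> I \<Longrightarrow> 0 < c i \<and> c i < 1" and "s < t"
  shows "(\<Sum>i\<in>I. c i powr t) < (\<Sum>i\<in>I. c i powr s)"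
  using assms by (intro sum_strict_mono powr_less_mono') auto

lemma uniform_ratio_bound:
  fixes c :: "'i \<Rightarrow> real"
  assumes "finite I" and "\<And>i. i \<in> I \<Longrightarrow> 0 < c i \<and> c i < 1"
  obtains m where "0 < m" and "m < 1" and "\<And>i. i \<in> I \<Longrightarrow> c i \<le> m"
proof (rule that[of "Max (insert (1/2) (c ` I))"])
  have fin: "finite (insert (1/2) (c ` I))" using assms(1) by simp
  show "Max (insert (1/2) (c ` I)) < 1" using fin assms(2) by (subst Max_less_iff) auto
  have "1/2 \<le> Max (insert (1/2) (c ` I))" by (rule Max_ge[OF fin]) simp
  then show "0 < Max (insert (1/2) (c ` I))" by linarith
  show "c i \<le> Max (insert (1/2) (c ` I))" if "i \<in> I" for i
    using that by (intro Max_ge[OF fin]) auto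
qed

text \<open>Dividing a scale by a ratio enlarges it by at least a fixed factor, so the recursion reaches
  \<open>\<eta>\<close> after finitely many steps. This replaces a sum over the words whose ratio just exceeds
  the scale.\<close>

lemma descending_scale_induct:
  fixes c :: "'i \<Rightarrow> real"
  assumes "finite I" and c: "\<And>i. i \<in> I \<Longrightarrow> 0 < c i \<and> c i < 1" and "0 < \<eta>" and "0 < r"
    and base: "\<And>r. \<eta> \<le> r \<Longrightarrow> P r"
    and step: "\<And>r. \<lbrakk>0 < r; r < \<eta>; \<And>i. i \<in> I \<Longrightarrow> P (r / c i)\<rbrakk> \<Longrightarrow> P r"
  shows "P r"
proof -
  obtain m where m: "0 < m" "m < 1" "\<And>i. i \<in> I \<Longrightarrow> c i \<le> m"
    using uniform_ratio_bound[of I c] \<open>finite I\<close> c by blast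
  have *: "P r" if "0 < r" "\<eta> * m ^ n \<le> r" for n r
    using that
  proof (induction n arbitrary: r)
    case 0
    then show ?case using base by simp
  next
    case (Suc n)
    show ?case
    proof (cases "\<eta> \<le> r")
      case False
      have "P (r / c i)" if i: "i \<in> I" for i
      proof (rule Suc.IH)
        show "0 < r / c i" using c[OF i] \<open>0 < r\<close> by simp
        have "\<eta> * m ^ n * c i \<le> \<eta> * m ^ n * m"
          using m \<open>0 < \<eta>\<close> i by (intro mult_left_mono) auto
        also have "\<dots> \<le> r" using Suc.prems(2) by (simp add: mult_ac)
        finally show "\<eta> * m ^ n \<le> r / c i" using c[OF i] by (simp add: field_simps)
      qed
      then show ?thesis using step[of r] False Suc.prems(1) by auto
    qed (rule base)
  qed
  obtain n where "m ^ n < r / \<eta>"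
    using real_arch_pow_inv[of "r / \<eta>" m] m(2) \<open>0 < r\<close> \<open>0 < \<eta>\<close> by auto
  then show ?thesis using *[of r n] \<open>0 < r\<close> \<open>0 < \<eta>\<close> by (simp add: field_simps)
qed

definition words :: "nat \<Rightarrow> nat \<Rightarrow> nat list set" where
  "words N n = {v. set v \<subseteq> {1..N} \<and> length v = n}"

primrec word_map :: "(nat \<Rightarrow> 'a \<Rightarrow> 'a) \<Rightarrow> nat list \<Rightarrow> 'a \<Rightarrow> 'a" where
  "word_map S [] = id"
| "word_map S (i # v) = S i \<circ> word_map S v"

definition word_ratio :: "(nat \<Rightarrow> 'a::metric_space \<Rightarrow> 'a) \<Rightarrow> nat list \<Rightarrow> real" where
  "word_ratio S v = (\<Prod>i\<leftarrow>v. Lip (S i))"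

lemma finite_words: "finite (words N n)"
  unfolding words_def by (rule finite_lists_length_eq) simp

lemma words_Suc: "words N (Suc n) = (\<lambda>(i, v). i # v) ` ({1..N} \<times> words N n)"
  unfolding words_def by (auto simp: length_Suc_conv image_iff)

lemma sum_word_ratio_powr:
  fixes S :: "nat \<Rightarrow> 'a::metric_space \<Rightarrow> 'a"
  assumes "similarity_ifs N S"
  shows "(\<Sum>v\<in>words N n. word_ratio S v powr \<sigma>) = (\<Sum>i=1..N. Lip (S i) powr \<sigma>) ^ n"
proof (induction n)
  case 0
  have "words N 0 = {[]}" by (auto simp: words_def)
  then show ?case by (simp add: word_ratio_def)
next
  case (Suc n)
  have "(\<Sum>v\<in>words N (Suc n). word_ratio S v powr \<sigma>)
      = (\<Sum>(i, v)\<in>{1..N} \<times> words N n. word_ratio S (i # v) powr \<sigma>)"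
    unfolding words_Suc by (subst sum.reindex) (auto simp: inj_on_def case_prod_unfold)
  also have "\<dots> = (\<Sum>i=1..N. \<Sum>v\<in>words N n. Lip (S i) powr \<sigma> * word_ratio S v powr \<sigma>)"
    by (simp add: sum.cartesian_product word_ratio_def powr_mult)
  also have "\<dots> = (\<Sum>i=1..N. Lip (S i) powr \<sigma>) * (\<Sum>v\<in>words N n. word_ratio S v powr \<sigma>)"
    by (simp add: sum_product)
  finally show ?case using Suc by simp
qed

lemma word_ratio_bounds:
  assumes "similarity_ifs N S" and "v \<in> words N n"
  shows "0 < word_ratio S v" and "word_ratio S v \<le> 1"
proof -
  have "0 < word_ratio S v \<and> word_ratio S v \<le> 1"
    using assms(2)
  proof (induction n arbitrary: v)
    case 0
    then show ?case by (simp add: words_def word_ratio_def)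
  next
    case (Suc n)
    then obtain i u where "v = i # u" "i \<in> {1..N}" "u \<in> words N n"
      unfolding words_Suc by auto
    then show ?case
      using Suc.IH[of u] similarity_ifsD(1,2)[OF assms(1), of i]
      by (auto simp: word_ratio_def intro!: mult_le_one)
  qed
  then show "0 < word_ratio S v" "word_ratio S v \<le> 1" by auto
qed

lemma word_ratio_small:
  fixes S :: "nat \<Rightarrow> 'a::metric_space \<Rightarrow> 'a"
  assumes "similarity_ifs N S" and "0 < e"
  obtains n where "\<And>v. v \<in> words N n \<Longrightarrow> word_ratio S v < e"
proof -
  obtain m where m: "0 < m" "m < 1" "\<And>i. i \<in> {1..N} \<Longrightarrow> Lip (S i) \<le> m"
    using uniform_ratio_bound[of "{1..N}" "\<lambda>i. Lip (S i)"] similarity_ifsD(1,2)[OF assms(1)] by blast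
  have le: "word_ratio S v \<le> m ^ n" if "v \<in> words N n" for v n
    using that
  proof (induction n arbitrary: v)
    case 0
    then show ?case by (simp add: words_def word_ratio_def)
  next
    case (Suc n)
    then obtain i u where iu: "v = i # u" "i \<in> {1..N}" "u \<in> words N n"
      unfolding words_Suc by auto
    then have "Lip (S i) * word_ratio S u \<le> m * m ^ n"
      using Suc.IH[of u] m word_ratio_bounds(1)[OF assms(1), of u]
      by (intro mult_mono) (auto intro: less_imp_le)
    then show ?case using iu by (simp add: word_ratio_def)
  qed
  obtain n where "m ^ n < e" using real_arch_pow_inv[OF \<open>0 < e\<close> m(2)] by blast
  then show thesis using that[of n] le by fastforce
qed

lemma dist_word_map:
  assumes "similarity_ifs N S" and "set v \<subseteq> {1..N}"
  shows "dist (word_map S v x) (word_map S v y) = word_ratio S v * dist x y"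
  using assms(2)
  by (induction v) (auto simp: word_ratio_def similarity_ifsD(3)[OF assms(1)])

lemma word_map_image_subset:
  assumes "\<And>i. i \<in> I \<Longrightarrow> S i ` U \<subseteq> U" and "set v \<subseteq> I"
  shows "word_map S v ` U \<subseteq> U"
  using assms(2)
proof (induction v)
  case (Cons i v)
  then have "S i ` word_map S v ` U \<subseteq> S i ` U" by (intro image_mono) simp
  then show ?case using assms(1)[of i] Cons.prems by (simp add: image_comp)
qed simp

text \<open>At the first letter where two words differ, the images of \<open>U\<close> lie in disjoint sets; the
  common prefix preserves disjointness because similarities are injective.\<close>

lemma word_map_disjoint:
  assumes ifs: "similarity_ifs N S"
    and sub: "\<And>i. i \<in> {1..N} \<Longrightarrow> S i ` U \<subseteq> U"
    and disj: "disjoint_family_on (\<lambda>i. S i ` U) {1..N}"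
    and "u \<in> words N n" and "v \<in> words N n" and "u \<noteq> v"
  shows "word_map S u ` U \<inter> word_map S v ` U = {}"
  using assms(4-6)
proof (induction n arbitrary: u v)
  case 0
  then show ?case by (simp add: words_def)
next
  case (Suc n)
  obtain i a where u: "u = i # a" "i \<in> {1..N}" "a \<in> words N n"
    using Suc.prems(1) unfolding words_Suc by auto
  obtain j b where v: "v = j # b" "j \<in> {1..N}" "b \<in> words N n"
    using Suc.prems(2) unfolding words_Suc by auto
  have ab: "word_map S a ` U \<subseteq> U" "word_map S b ` U \<subseteq> U"
    using u(3) v(3) word_map_image_subset[of "{1..N}" S U] sub by (auto simp: words_def)
  show ?case
  proof (cases "i = j")
    case False
    then have "S i ` U \<inter> S j ` U = {}"
      using disj u v unfolding disjoint_family_on_def by blast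
    moreover have "word_map S u ` U \<subseteq> S i ` U" "word_map S v ` U \<subseteq> S j ` U"
      using ab u(1) v(1) by (auto simp: image_subset_iff)
    ultimately show ?thesis by blast
  next
    case True
    have "inj (S i)"
    proof (rule injI)
      fix x y assume "S i x = S i y"
      then show "x = y"
        using similarity_ifsD(1)[OF ifs u(2)] similarity_ifsD(3)[OF ifs u(2), of x y] by auto
    qed
    then have "word_map S u ` U \<inter> word_map S v ` U = S i ` (word_map S a ` U \<inter> word_map S b ` U)"
      using u v True by (simp add: image_Int image_comp)
    then show ?thesis using Suc True u v by auto
  qed
qed

lemma attractor_image_subset:
  assumes "is_attractor N S C F" and "i \<in> {1..N}"
  shows "S i ` F \<subseteq> F"
proof -
  have "F = (\<Union>i\<in>{1..N}. S i ` F) \<union> C" using assms(1) by (simp add: is_attractor_def)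
  then show ?thesis using assms(2) by blast
qed

lemma attractor_subset_word_images:
  assumes "is_attractor N S {} F" and "x \<in> F"
  shows "\<exists>v\<in>words N n. x \<in> word_map S v ` F"
  using assms(2)
proof (induction n arbitrary: x)
  case 0
  then show ?case by (simp add: words_def)
next
  case (Suc n)
  then obtain i y where iy: "i \<in> {1..N}" "y \<in> F" "x = S i y"
    using assms(1) unfolding is_attractor_def by blast
  with Suc.IH[of y] obtain v where "v \<in> words N n" "y \<in> word_map S v ` F" by blast
  then show ?case using iy unfolding words_Suc by (intro bexI[of _ "i # v"]) auto
qed

section \<open>The upper bound for the attractor with condensation\<close>

text \<open>The bound is a supersolution of the recursion $N_r(F) \le N_r(C) + \sum_i N_{r/c_i}(F)$.
  The constant \<open>A\<close> must be uniform in both \<open>\<delta>\<close> and \<open>M\<close>, since \<open>M\<close> is later taken to be a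
  negative power of \<open>\<delta>\<close>.\<close>

lemma covering_number_attractor_le:
  fixes S :: "nat \<Rightarrow> 'a::metric_space \<Rightarrow> 'a"
  assumes X: "compact (UNIV :: 'a set)" and ifs: "similarity_ifs N S"
    and F: "is_attractor N S C F"
    and "0 \<le> t" and "0 \<le> u"
    and sum_t: "(\<Sum>i=1..N. Lip (S i) powr t) < 1" and sum_u: "(\<Sum>i=1..N. Lip (S i) powr u) < 1"
  obtains A where "0 < A"
    and "\<And>\<delta> M. \<lbrakk>0 < \<delta>; \<delta> \<le> 1; 0 \<le> M;
               \<And>r. \<lbrakk>\<delta> \<le> r; r \<le> 1\<rbrakk> \<Longrightarrow> covering_number r C \<le> r powr (- t) + M\<rbrakk>
           \<Longrightarrow> covering_number \<delta> F \<le> A * (\<delta> powr (- t) + M * \<delta> powr (- u))"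
proof -
  define c where "c i = Lip (S i)" for i
  define L where "L = (\<Sum>i=1..N. c i powr t)"
  define R where "R = (\<Sum>i=1..N. c i powr u)"
  have L: "L < 1" and R: "R < 1" using sum_t sum_u by (auto simp: L_def R_def c_def)
  have c: "0 < c i \<and> c i < 1" if "i \<in> {1..N}" for i
    using similarity_ifsD[OF ifs that] by (simp add: c_def)
  define m where "m = Min (insert 1 (c ` {1..N}))"
  have m: "0 < m" "m \<le> 1" and m_le: "\<And>i. i \<in> {1..N} \<Longrightarrow> m \<le> c i"
  proof -
    have fin: "finite (insert 1 (c ` {1..N}))" by simp
    show "0 < m" unfolding m_def using fin c by (subst Min_gr_iff) auto
    show "m \<le> 1" unfolding m_def by (rule Min_le[OF fin]) simp
    show "m \<le> c i" if "i \<in> {1..N}" for i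
      unfolding m_def using that by (intro Min_le[OF fin]) auto
  qed
  define K where "K = real (covering_number 1 F)"
  \<comment> \<open>The first two terms let the slack in the two sums absorb $N_r(C)$; the third covers the
    scales between $1$ and $1/m$, to which a scale below $1$ can jump in one step.\<close>
  define A where "A = 1 / (1 - L) + 1 / (1 - R) + K * m powr (- t)"
  have A: "0 < A" "1 \<le> A * (1 - L)" "1 \<le> A * (1 - R)" "K \<le> A * m powr t"
  proof -
    have K: "0 \<le> K * m powr (- t)" by (simp add: K_def)
    have 1: "0 < 1 / (1 - L)" "0 < 1 / (1 - R)" using L R by auto
    show "0 < A" unfolding A_def using K 1 by linarith
    have "1 / (1 - L) \<le> A" "1 / (1 - R) \<le> A" unfolding A_def using K 1 by linarith+
    then show "1 \<le> A * (1 - L)" "1 \<le> A * (1 - R)" using L R by (simp_all add: pos_divide_le_eq)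
    have "K * m powr (- t) \<le> A" unfolding A_def using 1 by linarith
    then have "K * m powr (- t) * m powr t \<le> A * m powr t" by (rule mult_right_mono) simp
    then show "K \<le> A * m powr t" using m(1) by (simp add: powr_add[symmetric] mult.assoc)
  qed
  have "covering_number \<delta> F \<le> A * (\<delta> powr (- t) + M * \<delta> powr (- u))"
    if "0 < \<delta>" "\<delta> \<le> 1" "0 \<le> M"
      and C: "\<And>r. \<lbrakk>\<delta> \<le> r; r \<le> 1\<rbrakk> \<Longrightarrow> covering_number r C \<le> r powr (- t) + M" for \<delta> M
  proof -
    let ?bound = "\<lambda>r. A * (r powr (- t) + M * r powr (- u))"
    have "\<delta> \<le> \<delta> \<and> \<delta> * m \<le> 1 \<longrightarrow> covering_number \<delta> F \<le> ?bound \<delta>"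
    proof (rule descending_scale_induct[where I = "{1..N}" and c = c and \<eta> = 1
          and P = "\<lambda>r. \<delta> \<le> r \<and> r * m \<le> 1 \<longrightarrow> covering_number r F \<le> ?bound r"])
      fix r :: real assume "1 \<le> r"
      show "\<delta> \<le> r \<and> r * m \<le> 1 \<longrightarrow> covering_number r F \<le> ?bound r"
      proof (intro impI, elim conjE)
        assume "r * m \<le> 1"
        have "real (covering_number r F) \<le> K" unfolding K_def
          using covering_number_antimono[OF X, of 1 r F] \<open>1 \<le> r\<close> by simp
        also have "\<dots> \<le> A * m powr t" by (rule A)
        also have "m powr t \<le> (1 / r) powr t"
          using \<open>r * m \<le> 1\<close> \<open>1 \<le> r\<close> m(1) \<open>0 \<le> t\<close> by (intro powr_mono2) (auto simp: field_simps)
        also have "(1 / r) powr t = r powr (- t)"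
          using \<open>1 \<le> r\<close> by (simp add: powr_divide powr_minus_divide)
        also have "A * r powr (- t) \<le> ?bound r" using A(1) \<open>0 \<le> M\<close> by (intro mult_left_mono) auto
        finally show "covering_number r F \<le> ?bound r" using A(1) by simp
      qed
    next
      fix r :: real
      assume r: "0 < r" "r < 1"
        and IH: "\<And>i. i \<in> {1..N} \<Longrightarrow>
          \<delta> \<le> r / c i \<and> r / c i * m \<le> 1 \<longrightarrow> covering_number (r / c i) F \<le> ?bound (r / c i)"
      show "\<delta> \<le> r \<and> r * m \<le> 1 \<longrightarrow> covering_number r F \<le> ?bound r"
      proof (intro impI, elim conjE)
        assume "\<delta> \<le> r"
        have piece: "real (covering_number r (S i ` F))
            \<le> A * r powr (- t) * c i powr t + A * M * r powr (- u) * c i powr u"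
          if i: "i \<in> {1..N}" for i
        proof -
          have ci: "0 < c i" "c i < 1" "m \<le> c i" using c[OF i] m_le[OF i] by auto
          have "r * c i \<le> r" using ci r by (simp add: mult_left_le)
          then have "r \<le> r / c i" using ci by (simp add: field_simps)
          moreover have "r * m \<le> 1 * c i" using r ci m by (intro mult_mono) auto
          ultimately have "covering_number (r / c i) F \<le> ?bound (r / c i)"
            using IH[OF i] \<open>\<delta> \<le> r\<close> ci(1) by (simp add: pos_divide_le_eq)
          moreover have "covering_number r (S i ` F) = covering_number (r / c i) F"
            using similarity_ifsD(3)[OF ifs i] ci r
            by (intro covering_number_similarity_image[OF X]) (auto simp: c_def)
          moreover have "(r / c i) powr (- e) = r powr (- e) * c i powr e" for e
            using r ci by (simp add: powr_divide powr_minus_divide)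
          ultimately show ?thesis by (simp add: algebra_simps)
        qed
        have "real (covering_number r F) = covering_number r ((\<Union>i\<in>{1..N}. S i ` F) \<union> C)"
          using F unfolding is_attractor_def by metis
        also have "\<dots> \<le> (\<Sum>i=1..N. covering_number r (S i ` F)) + covering_number r C"
          using covering_number_Un[OF X r(1), of "\<Union>i\<in>{1..N}. S i ` F" C]
            covering_number_UN[OF X r(1), of "{1..N}" "\<lambda>i. S i ` F"]
          by (simp flip: of_nat_sum of_nat_add)
        also have "\<dots> \<le> (\<Sum>i=1..N. A * r powr (- t) * c i powr t + A * M * r powr (- u) * c i powr u)
            + (r powr (- t) + M)"
          using C[OF \<open>\<delta> \<le> r\<close>] r piece by (auto intro!: add_mono sum_mono)
        also have "\<dots> = A * L * r powr (- t) + A * R * (M * r powr (- u)) + r powr (- t) + M"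
          unfolding L_def R_def by (simp add: sum.distrib sum_distrib_left sum_distrib_right mult_ac)
        also have "\<dots> \<le> ?bound r"
        proof -
          have "r powr 0 \<le> r powr (- u)" using r \<open>0 \<le> u\<close> by (intro powr_mono') auto
          then have "M * 1 \<le> M * r powr (- u)" using r \<open>0 \<le> M\<close> by (intro mult_left_mono) auto
          also have "\<dots> \<le> A * (1 - R) * (M * r powr (- u))"
            using A(3) \<open>0 \<le> M\<close> mult_right_mono[of 1 "A * (1 - R)" "M * r powr (- u)"] by simp
          finally have "M \<le> A * (1 - R) * (M * r powr (- u))" by simp
          moreover have "r powr (- t) \<le> A * (1 - L) * r powr (- t)"
            using A(2) mult_right_mono[of 1 "A * (1 - L)" "r powr (- t)"] by simp
          ultimately show ?thesis by (simp add: algebra_simps)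
        qed
        finally show "covering_number r F \<le> ?bound r" .
      qed
    qed (use c \<open>0 < \<delta>\<close> in auto)
    moreover have "\<delta> * m \<le> 1" using \<open>\<delta> \<le> 1\<close> \<open>0 < \<delta>\<close> m by (simp add: mult_le_one)
    ultimately show ?thesis by simp
  qed
  with A(1) show thesis by (rule that)
qed

text \<open>Scales above $\delta^q$ are controlled by monotonicity from the scale $\delta^q$, which
  contributes $M = \delta^{-qt}$ to the preceding bound.\<close>

lemma lower_box_dim_attractor_le:
  fixes S :: "nat \<Rightarrow> 'a::metric_space \<Rightarrow> 'a"
  assumes X: "compact (UNIV :: 'a set)" and ifs: "similarity_ifs N S"
    and F: "is_attractor N S C F"
    and "0 \<le> t" and "0 \<le> u" and "0 \<le> q" and "q \<le> 1"
    and sum_t: "(\<Sum>i=1..N. Lip (S i) powr t) < 1" and sum_u: "(\<Sum>i=1..N. Lip (S i) powr u) < 1"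
    and freq: "frequently (\<lambda>\<delta>. \<forall>r. \<delta> \<le> r \<and> r \<le> \<delta> powr q \<longrightarrow> covering_number r C \<le> r powr (- t)) (at_right 0)"
  shows "lower_box_dim F \<le> ereal (max t (u + q * t))"
proof -
  obtain A where A: "0 < A" and bound: "\<And>\<delta> M. \<lbrakk>0 < \<delta>; \<delta> \<le> 1; 0 \<le> M;
               \<And>r. \<lbrakk>\<delta> \<le> r; r \<le> 1\<rbrakk> \<Longrightarrow> covering_number r C \<le> r powr (- t) + M\<rbrakk>
           \<Longrightarrow> covering_number \<delta> F \<le> A * (\<delta> powr (- t) + M * \<delta> powr (- u))"
    using covering_number_attractor_le[OF X ifs F \<open>0 \<le> t\<close> \<open>0 \<le> u\<close> sum_t sum_u] by blast
  define v where "v = max t (u + q * t)"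
  have ev: "eventually (\<lambda>\<delta>::real. 0 < \<delta> \<and> \<delta> < 1) (at_right 0)"
    unfolding eventually_at_right_field by (intro exI[of _ 1]) auto
  have "frequently (\<lambda>\<delta>. covering_number \<delta> F \<le> (A * 2) * \<delta> powr (- v)) (at_right 0)"
    using frequently_eventually_frequently[OF freq ev]
  proof (rule frequently_elim1)
    fix \<delta> :: real
    assume "(\<forall>r. \<delta> \<le> r \<and> r \<le> \<delta> powr q \<longrightarrow> covering_number r C \<le> r powr (- t)) \<and> 0 < \<delta> \<and> \<delta> < 1"
    then have \<delta>: "0 < \<delta>" "\<delta> < 1"
      and C: "\<And>r. \<lbrakk>\<delta> \<le> r; r \<le> \<delta> powr q\<rbrakk> \<Longrightarrow> covering_number r C \<le> r powr (- t)" by auto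
    have \<delta>q: "\<delta> \<le> \<delta> powr q" using powr_mono'[of q 1 \<delta>] \<delta> \<open>q \<le> 1\<close> by simp
    have "covering_number \<delta> F \<le> A * (\<delta> powr (- t) + \<delta> powr (- (q * t)) * \<delta> powr (- u))"
    proof (rule bound)
      fix r assume r: "\<delta> \<le> r" "r \<le> 1"
      show "covering_number r C \<le> r powr (- t) + \<delta> powr (- (q * t))"
      proof (cases "r \<le> \<delta> powr q")
        case True
        then show ?thesis using C[OF r(1)] by (simp add: add_increasing2)
      next
        case False
        then have "real (covering_number r C) \<le> covering_number (\<delta> powr q) C"
          using covering_number_antimono[OF X, of "\<delta> powr q" r C] \<delta> by simp
        also have "\<dots> \<le> \<delta> powr (- (q * t))" using C[of "\<delta> powr q"] \<delta>q by (simp add: powr_powr)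
        finally show ?thesis by (simp add: add_increasing)
      qed
    qed (use \<delta> in auto)
    also have "\<dots> = A * (\<delta> powr (- t) + \<delta> powr (- (u + q * t)))"
      by (simp add: powr_add[symmetric] add.commute)
    also have "\<dots> \<le> A * (\<delta> powr (- v) + \<delta> powr (- v))"
      using A \<delta> by (intro mult_left_mono add_mono powr_mono') (auto simp: v_def)
    finally show "covering_number \<delta> F \<le> (A * 2) * \<delta> powr (- v)" by simp
  qed
  then show ?thesis
    unfolding v_def using F A by (intro lower_box_dim_le_of_frequently[OF X]) (auto simp: is_attractor_def)
qed

section \<open>Covering regularity exponents\<close>

lemma cov_reg_exp_at_bounds:
  fixes C :: "'a::metric_space set"
  assumes X: "compact (UNIV :: 'a set)" and "C \<noteq> {}" and "0 < \<delta>"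
  shows "0 \<le> cov_reg_exp_at t \<delta> C" and "cov_reg_exp_at t \<delta> C \<le> 1"
proof -
  let ?P = "{p \<in> {0..1}. real (covering_number (\<delta> powr p) C) \<ge> \<delta> powr (- (p * t))}"
  have 0: "0 \<in> ?P"
    using covering_number_ge_1[OF X, of "\<delta> powr 0" C] assms(2,3)
    by (simp only: mem_Collect_eq) simp
  have bdd: "bdd_above ?P" by (rule bdd_aboveI[of _ 1]) auto
  show "0 \<le> cov_reg_exp_at t \<delta> C" unfolding cov_reg_exp_at_def using 0 bdd by (rule cSup_upper)
  show "cov_reg_exp_at t \<delta> C \<le> 1" unfolding cov_reg_exp_at_def
  proof (rule cSup_least)
    show "?P \<noteq> {}" using 0 by blast
  qed auto
qed

lemma cov_reg_exp_bounds:
  fixes C :: "'a::metric_space set"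
  assumes X: "compact (UNIV :: 'a set)" and "C \<noteq> {}"
  shows "0 \<le> cov_reg_exp t C" and "cov_reg_exp t C \<le> 1"
proof -
  have ev: "eventually (\<lambda>\<delta>::real. 0 < \<delta>) (at_right 0)"
    by (rule eventually_at_right_less)
  show "0 \<le> cov_reg_exp t C" unfolding cov_reg_exp_def
    using cov_reg_exp_at_bounds(1)[OF assms]
    by (intro Liminf_bounded eventually_mono[OF ev]) auto
  have "cov_reg_exp t C \<le> Limsup (at_right 0) (\<lambda>\<delta>. ereal (cov_reg_exp_at t \<delta> C))"
    unfolding cov_reg_exp_def by (rule Liminf_le_Limsup) simp
  also have "\<dots> \<le> 1"
    using cov_reg_exp_at_bounds(2)[OF assms]
    by (intro Limsup_bounded eventually_mono[OF ev]) auto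
  finally show "cov_reg_exp t C \<le> 1" .
qed

lemma covering_number_less_of_cov_reg_exp_at_less:
  assumes "cov_reg_exp_at t \<delta> C < p" and "0 \<le> p" and "p \<le> 1"
  shows "covering_number (\<delta> powr p) C < \<delta> powr (- (p * t))"
proof (rule ccontr)
  assume "\<not> ?thesis"
  then have "p \<le> cov_reg_exp_at t \<delta> C" unfolding cov_reg_exp_at_def
    using assms(2,3) by (intro cSup_upper bdd_aboveI[of _ 1]) auto
  with assms(1) show False by simp
qed

text \<open>For $q < 1$ the scales come from the covering regularity exponent. For $q = 1$ the range
  of \<open>r\<close> is the single scale \<open>\<delta>\<close>, and the lower box dimension of \<open>C\<close> provides it.\<close>

lemma frequently_regular_scale_range:
  fixes C :: "'a::metric_space set"
  assumes X: "compact (UNIV :: 'a set)" and "C \<noteq> {}" and "lower_box_dim C < ereal t"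
    and "0 \<le> q" and "q \<le> 1" and q: "cov_reg_exp t C < ereal q \<or> q = 1"
  shows "frequently (\<lambda>\<delta>. \<forall>r. \<delta> \<le> r \<and> r \<le> \<delta> powr q \<longrightarrow> covering_number r C \<le> r powr (- t)) (at_right 0)"
proof (cases "q = 1")
  case True
  from frequently_covering_number_less[OF X assms(2,3)] show ?thesis
    by (rule frequently_elim1) (use True in \<open>auto simp: order.order_iff_strict\<close>)
next
  case False
  have ev: "eventually (\<lambda>\<delta>::real. 0 < \<delta> \<and> \<delta> < 1) (at_right 0)"
    unfolding eventually_at_right_field by (intro exI[of _ 1]) auto
  have "frequently (\<lambda>\<delta>. ereal (cov_reg_exp_at t \<delta> C) < ereal q) (at_right 0)"
    using q False unfolding cov_reg_exp_def by (intro frequently_less_of_Liminf_less) simp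
  from frequently_eventually_frequently[OF this ev] show ?thesis
  proof (rule frequently_elim1, intro allI impI)
    fix \<delta> r :: real
    assume "ereal (cov_reg_exp_at t \<delta> C) < ereal q \<and> 0 < \<delta> \<and> \<delta> < 1" and r: "\<delta> \<le> r \<and> r \<le> \<delta> powr q"
    then have \<delta>: "cov_reg_exp_at t \<delta> C < q" "0 < \<delta>" "\<delta> < 1" by auto
    define p where "p = ln r / ln \<delta>"
    have "0 < r" using r \<delta> by linarith
    have rp: "r = \<delta> powr p" using \<delta> \<open>0 < r\<close> by (simp add: p_def powr_def)
    have "ln \<delta> \<le> ln r" using r \<delta> \<open>0 < r\<close> by simp
    then have p1: "p \<le> 1" using \<delta> by (simp add: p_def field_simps)
    have "ln r \<le> ln (\<delta> powr q)" using r \<delta> \<open>0 < r\<close> by (intro ln_mono) auto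
    then have qp: "q \<le> p" using \<delta> by (simp add: p_def field_simps ln_powr)
    then have "covering_number (\<delta> powr p) C < \<delta> powr (- (p * t))"
      using \<delta> p1 \<open>0 \<le> q\<close> by (intro covering_number_less_of_cov_reg_exp_at_less) auto
    then show "covering_number r C \<le> r powr (- t)" by (simp add: rp powr_powr)
  qed
qed

section \<open>The lower bound under the strong open set condition\<close>

lemma disjoint_compact_separated:
  fixes A B :: "'a::metric_space set"
  assumes "compact A" and "compact B" and "A \<inter> B = {}"
  obtains d where "0 < d" and "\<And>x y. \<lbrakk>x \<in> A; y \<in> B\<rbrakk> \<Longrightarrow> d \<le> dist x y"
proof (cases "A = {} \<or> B = {}")
  case True
  then show thesis using that[of 1] by auto
next
  case False
  have "continuous_on A (\<lambda>x. infdist x B)" by (intro continuous_intros)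
  then obtain a where a: "a \<in> A" "\<And>x. x \<in> A \<Longrightarrow> infdist a B \<le> infdist x B"
    using continuous_attains_inf[of A "\<lambda>x. infdist x B"] False assms(1) by blast
  have "infdist a B \<noteq> 0"
    using in_closed_iff_infdist_zero[of B a] a(1) assms False compact_imp_closed by auto
  then have "0 < infdist a B" using infdist_nonneg[of a B] by linarith
  moreover have "infdist a B \<le> dist x y" if "x \<in> A" "y \<in> B" for x y
    using a(2)[OF that(1)] infdist_le[OF that(2), of x] by linarith
  ultimately show thesis by (rule that)
qed

lemma finite_disjoint_compact_family_separated:
  fixes A :: "'i \<Rightarrow> 'a::metric_space set"
  assumes "finite J" and "\<And>j. j \<in> J \<Longrightarrow> compact (A j)" and "disjoint_family_on A J"
  obtains d where "0 < d"
    and "\<And>i j x y. \<lbrakk>i \<in> J; j \<in> J; i \<noteq> j; x \<in> A i; y \<in> A j\<rbrakk> \<Longrightarrow> d \<le> dist x y"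
proof -
  have "\<exists>d>0. \<forall>x\<in>A i. \<forall>y\<in>A j. d \<le> dist x y" if "i \<in> J" "j \<in> J" "i \<noteq> j" for i j
    using disjoint_compact_separated[of "A i" "A j"] that assms(2,3)
    unfolding disjoint_family_on_def by metis
  then obtain d where d: "\<And>i j. \<lbrakk>i \<in> J; j \<in> J; i \<noteq> j\<rbrakk> \<Longrightarrow> 0 < d i j \<and> (\<forall>x\<in>A i. \<forall>y\<in>A j. d i j \<le> dist x y)"
    by metis
  let ?P = "{(i, j) \<in> J \<times> J. i \<noteq> j}"
  let ?D = "insert 1 (case_prod d ` ?P)"
  have fin: "finite ?D" using assms(1) by (auto intro: finite_subset[of _ "J \<times> J"])
  show thesis
  proof (rule that[of "Min ?D"])
    show "0 < Min ?D" using fin d by (auto simp: Min_gr_iff)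
    fix i j x y assume ij: "i \<in> J" "j \<in> J" "i \<noteq> j" "x \<in> A i" "y \<in> A j"
    then have "Min ?D \<le> d i j" using fin by (intro Min_le) auto
    then show "Min ?D \<le> dist x y" using d[of i j] ij by fastforce
  qed
qed

lemma similarity_image_compact:
  fixes f :: "'a::metric_space \<Rightarrow> 'b::metric_space"
  assumes "\<And>x y. dist (f x) (f y) = c * dist x y" and "0 \<le> c" and "compact E"
  shows "compact (f ` E)"
proof -
  have "c-lipschitz_on E f" using assms by (intro lipschitz_onI) auto
  then show ?thesis using assms(3) by (intro compact_continuous_image lipschitz_on_continuous_on)
qed

text \<open>Below the separation of the pieces, a multiple of $r^{-\sigma}$ is a subsolution of
  $N_r(E) \ge \sum_j N_{r/d_j}(E)$.\<close>

lemma lower_box_dim_ge_of_disjoint_similar_pieces: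
  fixes E :: "'a::metric_space set" and T :: "'j \<Rightarrow> 'a \<Rightarrow> 'a"
  assumes X: "compact (UNIV :: 'a set)" and "finite J" and "E \<noteq> {}" and "compact E"
    and T: "\<And>j x y. j \<in> J \<Longrightarrow> dist (T j x) (T j y) = d j * dist x y"
    and d: "\<And>j. j \<in> J \<Longrightarrow> 0 < d j \<and> d j < 1"
    and sub: "\<And>j. j \<in> J \<Longrightarrow> T j ` E \<subseteq> E"
    and disj: "disjoint_family_on (\<lambda>j. T j ` E) J"
    and "0 \<le> \<sigma>" and ge_1: "1 \<le> (\<Sum>j\<in>J. d j powr \<sigma>)"
  shows "ereal \<sigma> \<le> lower_box_dim E"
proof -
  have "compact (T j ` E)" if "j \<in> J" for j
    using T[OF that] d[OF that] \<open>compact E\<close> by (intro similarity_image_compact) auto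
  then obtain \<eta> where \<eta>: "0 < \<eta>"
    and sep: "\<And>i j x y. \<lbrakk>i \<in> J; j \<in> J; i \<noteq> j; x \<in> T i ` E; y \<in> T j ` E\<rbrakk> \<Longrightarrow> \<eta> \<le> dist x y"
    using finite_disjoint_compact_family_separated[OF \<open>finite J\<close> _ disj] by blast
  \<comment> \<open>With this constant the bound is at most $1$ at all scales from $\eta$ upwards.\<close>
  define a where "a = \<eta> powr \<sigma>"
  have "0 < a" using \<eta> by (simp add: a_def)
  have "a * r powr (- \<sigma>) \<le> covering_number r E" if "0 < r" for r
    using \<open>finite J\<close> d \<eta> that
  proof (rule descending_scale_induct[where I = J and c = d])
    fix r assume "\<eta> \<le> r"
    then have "a * r powr (- \<sigma>) \<le> a * \<eta> powr (- \<sigma>)"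
      using \<eta> \<open>0 \<le> \<sigma>\<close> \<open>0 < a\<close> by (intro mult_left_mono powr_mono2') auto
    also have "\<dots> = 1" using \<eta> by (simp add: a_def powr_add[symmetric])
    also have "1 \<le> real (covering_number r E)"
      using covering_number_ge_1[OF X, of r E] \<open>E \<noteq> {}\<close> \<eta> \<open>\<eta> \<le> r\<close> by simp
    finally show "a * r powr (- \<sigma>) \<le> covering_number r E" .
  next
    fix r assume r: "0 < r" "r < \<eta>"
      and IH: "\<And>j. j \<in> J \<Longrightarrow> a * (r / d j) powr (- \<sigma>) \<le> covering_number (r / d j) E"
    have "a * r powr (- \<sigma>) * 1 \<le> a * r powr (- \<sigma>) * (\<Sum>j\<in>J. d j powr \<sigma>)"
      using ge_1 \<open>0 < a\<close> by (intro mult_left_mono) auto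
    also have "\<dots> = (\<Sum>j\<in>J. a * (r / d j) powr (- \<sigma>))"
      unfolding sum_distrib_left using d r
      by (intro sum.cong) (auto simp: powr_divide powr_minus_divide)
    also have "\<dots> \<le> (\<Sum>j\<in>J. real (covering_number (r / d j) E))"
      by (intro sum_mono IH)
    also have "\<dots> = (\<Sum>j\<in>J. real (covering_number r (T j ` E)))"
      using T d r by (intro sum.cong arg_cong[of _ _ real] covering_number_similarity_image[OF X, symmetric]) auto
    also have "\<dots> \<le> covering_number r E"
    proof -
      have "(\<Sum>j\<in>J. covering_number r (T j ` E)) \<le> covering_number r E"
        using sub sep r \<open>finite J\<close>
        by (intro sum_covering_number_separated_le[OF X]) (auto simp: less_le_trans)
      then show ?thesis by (simp flip: of_nat_sum)
    qed
    finally show "a * r powr (- \<sigma>) \<le> covering_number r E" by simp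
  qed
  then show ?thesis
    using \<open>E \<noteq> {}\<close> \<open>0 < a\<close> by (intro lower_box_dim_ge_of_powr_bound[OF X])
qed

text \<open>The open set condition alone yields disjoint images of \<open>U\<close>, but in a general metric space it
  gives no distance between them. Composing with a word \<open>w\<close> that maps the compact set \<open>F\<close> into
  \<open>U\<close> does; the price is the factor $c_w^\sigma$, which the growth of
  $(\sum_i c_i^\sigma)^n$ outweighs.\<close>

lemma SOSC_lower_box_dim_ge:
  fixes S :: "nat \<Rightarrow> 'a::metric_space \<Rightarrow> 'a"
  assumes X: "compact (UNIV :: 'a set)" and ifs: "similarity_ifs N S"
    and F: "is_attractor N S {} F" and "SOSC N S F"
    and "0 \<le> \<sigma>" and gt_1: "1 < (\<Sum>i=1..N. Lip (S i) powr \<sigma>)"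
  shows "ereal \<sigma> \<le> lower_box_dim F"
proof -
  obtain U where U: "open U" "F \<inter> U \<noteq> {}" "(\<Union>i\<in>{1..N}. S i ` U) \<subseteq> U"
    and disjU: "disjoint_family_on (\<lambda>i. S i ` U) {1..N}"
    using \<open>SOSC N S F\<close> unfolding SOSC_def by blast
  have F': "F \<noteq> {}" "compact F" "\<And>i. i \<in> {1..N} \<Longrightarrow> S i ` F \<subseteq> F"
    using F attractor_image_subset[OF F] unfolding is_attractor_def by auto
  have UU: "\<And>i. i \<in> {1..N} \<Longrightarrow> S i ` U \<subseteq> U" using U(3) by blast
  obtain x where "x \<in> F" "x \<in> U" using U(2) by blast
  moreover from openE[OF U(1) \<open>x \<in> U\<close>] obtain \<rho> where "0 < \<rho>" "ball x \<rho> \<subseteq> U" by metis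
  ultimately have x: "x \<in> F" "0 < \<rho>" "ball x \<rho> \<subseteq> U" by auto
  have bdd: "bounded F" using F'(2) by (rule compact_imp_bounded)
  obtain k where k: "\<And>v. v \<in> words N k \<Longrightarrow> word_ratio S v < \<rho> / (diameter F + 1)"
    using word_ratio_small[OF ifs, of "\<rho> / (diameter F + 1)"] \<open>0 < \<rho>\<close> diameter_ge_0[OF bdd] by auto
  obtain w z where w: "w \<in> words N k" "z \<in> F" "x = word_map S w z"
    using attractor_subset_word_images[OF F x(1), of k] by blast
  have w': "set w \<subseteq> {1..N}" using w(1) by (simp add: words_def)
  have w_pos: "0 < word_ratio S w" using word_ratio_bounds[OF ifs w(1)] by simp
  have wU: "word_map S w ` F \<subseteq> U"
  proof (rule image_subsetI)
    fix y assume "y \<in> F"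
    have "dist x (word_map S w y) = word_ratio S w * dist z y"
      using dist_word_map[OF ifs w'] w(3) by simp
    also have "\<dots> \<le> word_ratio S w * (diameter F + 1)"
      using diameter_bounded_bound[OF bdd w(2) \<open>y \<in> F\<close>] w_pos by (intro mult_left_mono) auto
    also have "\<dots> < \<rho>"
      using k[OF w(1)] diameter_ge_0[OF bdd] by (simp add: pos_less_divide_eq)
    finally show "word_map S w y \<in> U" using x(3) by auto
  qed
  define B where "B = (\<Sum>i=1..N. Lip (S i) powr \<sigma>)"
  obtain n0 where n0: "word_ratio S w powr (- \<sigma>) < B ^ n0"
    using real_arch_pow[of B] gt_1 unfolding B_def by blast
  \<comment> \<open>A positive length makes the ratio of the composed map less than $1$.\<close>
  define n where "n = Suc n0"
  have n: "word_ratio S w powr (- \<sigma>) \<le> B ^ n"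
  proof -
    have "B ^ n0 \<le> B ^ n" using gt_1 by (intro power_increasing) (auto simp: n_def B_def)
    with n0 show ?thesis by linarith
  qed
  show ?thesis
  proof (rule lower_box_dim_ge_of_disjoint_similar_pieces[OF X finite_words F'(1,2)])
    fix v assume v: "v \<in> words N n"
    then have v': "set v \<subseteq> {1..N}" by (simp add: words_def)
    show "dist ((word_map S v \<circ> word_map S w) x) ((word_map S v \<circ> word_map S w) y)
        = word_ratio S v * word_ratio S w * dist x y" for x y
      by (simp add: dist_word_map[OF ifs v'] dist_word_map[OF ifs w'])
    obtain i u where iu: "v = i # u" "i \<in> {1..N}" "u \<in> words N n0"
      using v unfolding n_def words_Suc by auto
    have "Lip (S i) * word_ratio S u < 1"
    proof -
      have "Lip (S i) * word_ratio S u \<le> Lip (S i)"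
        using similarity_ifsD(1)[OF ifs iu(2)] word_ratio_bounds[OF ifs iu(3)]
        by (intro mult_left_le) auto
      then show ?thesis using similarity_ifsD(2)[OF ifs iu(2)] by linarith
    qed
    then have "word_ratio S v < 1" using iu by (simp add: word_ratio_def)
    then show "0 < word_ratio S v * word_ratio S w \<and> word_ratio S v * word_ratio S w < 1"
    proof -
      have "word_ratio S v * word_ratio S w \<le> word_ratio S v"
        using word_ratio_bounds[OF ifs v] word_ratio_bounds[OF ifs w(1)]
        by (intro mult_left_le) auto
      then show ?thesis
        using \<open>word_ratio S v < 1\<close> word_ratio_bounds(1)[OF ifs v] w_pos
        by (intro conjI mult_pos_pos) linarith+
    qed
    have "word_map S v ` F \<subseteq> F" "word_map S w ` F \<subseteq> F"
      using word_map_image_subset[of "{1..N}" S F] F'(3) v' w' by auto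
    then show "(word_map S v \<circ> word_map S w) ` F \<subseteq> F" by auto
  next
    show "disjoint_family_on (\<lambda>v. (word_map S v \<circ> word_map S w) ` F) (words N n)"
      unfolding disjoint_family_on_def
    proof (intro ballI impI)
      fix u v assume "u \<in> words N n" "v \<in> words N n" "u \<noteq> v"
      then have "word_map S u ` U \<inter> word_map S v ` U = {}"
        using word_map_disjoint[OF ifs _ disjU, of u n v] UU by blast
      then show "(word_map S u \<circ> word_map S w) ` F \<inter> (word_map S v \<circ> word_map S w) ` F = {}"
        using wU by auto
    qed
  next
    show "0 \<le> \<sigma>" by fact
    have "1 = word_ratio S w powr (- \<sigma>) * word_ratio S w powr \<sigma>"
      using w_pos by (simp add: powr_add[symmetric])
    also have "\<dots> \<le> B ^ n * word_ratio S w powr \<sigma>" using n by (intro mult_right_mono) auto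
    also have "\<dots> = (\<Sum>v\<in>words N n. (word_ratio S v * word_ratio S w) powr \<sigma>)"
      unfolding B_def sum_word_ratio_powr[OF ifs, symmetric] sum_distrib_right
      using word_ratio_bounds[OF ifs] w_pos by (intro sum.cong) (auto simp: powr_mult less_imp_le)
    finally show "1 \<le> (\<Sum>v\<in>words N n. (word_ratio S v * word_ratio S w) powr \<sigma>)" .
  qed
qed

text \<open>The largest distance from a point of \<open>F0\<close> to \<open>F\<close> is attained at some $S_i(y)$ with
  \<open>y \<in> F0\<close>, so it is at most $c_i$ times itself and therefore vanishes.\<close>

lemma homogeneous_attractor_subset:
  fixes S :: "nat \<Rightarrow> 'a::metric_space \<Rightarrow> 'a"
  assumes ifs: "similarity_ifs N S" and F0: "is_attractor N S {} F0" and F: "is_attractor N S C F"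
  shows "F0 \<subseteq> F"
proof -
  have "continuous_on F0 (\<lambda>x. infdist x F)" by (intro continuous_intros)
  then obtain x where x: "x \<in> F0" "\<And>y. y \<in> F0 \<Longrightarrow> infdist y F \<le> infdist x F"
    using continuous_attains_sup[of F0 "\<lambda>x. infdist x F"] F0 unfolding is_attractor_def by blast
  obtain i y where i: "i \<in> {1..N}" "y \<in> F0" "x = S i y"
    using x(1) F0 unfolding is_attractor_def by blast
  have F': "F \<noteq> {}" "compact F" "S i ` F \<subseteq> F"
    using F attractor_image_subset[OF F i(1)] unfolding is_attractor_def by auto
  have "continuous_on F (dist y)" by (intro continuous_intros)
  then obtain z where z: "z \<in> F" "\<And>z'. z' \<in> F \<Longrightarrow> dist y z \<le> dist y z'"
    using continuous_attains_inf[OF F'(2,1), of "dist y"] by blast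
  have dz: "infdist y F = dist y z"
    unfolding infdist_def using z F'(1) by (auto intro!: cInf_eq_minimum)
  have "infdist x F \<le> dist x (S i z)" using F'(3) z(1) by (intro infdist_le) auto
  also have "\<dots> = Lip (S i) * infdist y F"
    using similarity_ifsD(3)[OF ifs i(1)] i(3) dz by simp
  also have "\<dots> \<le> Lip (S i) * infdist x F"
    using x(2)[OF i(2)] similarity_ifsD(1)[OF ifs i(1)] by (intro mult_left_mono) auto
  finally have "(1 - Lip (S i)) * infdist x F \<le> 0" by (simp add: algebra_simps)
  then have "infdist x F \<le> 0"
    using similarity_ifsD(2)[OF ifs i(1)] by (simp add: mult_le_0_iff)
  then have "infdist y F = 0" if "y \<in> F0" for y
    using x(2)[OF that] infdist_nonneg[of y F] by linarith
  then show ?thesis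
    using in_closed_iff_infdist_zero[OF compact_imp_closed[OF F'(2)] F'(1)] by blast
qed

section \<open>The lower box dimension of the inhomogeneous attractor\<close>

lemma similarity_dimension_nonneg:
  assumes ifs: "similarity_ifs N S" and s: "is_similarity_dimension N S s"
  shows "0 \<le> s"
proof (rule ccontr)
  assume "\<not> ?thesis"
  have N: "1 \<le> N" using ifs by (simp add: similarity_ifs_def)
  have "(\<Sum>i=1..N. Lip (S i) powr 0) < (\<Sum>i=1..N. Lip (S i) powr s)"
    using \<open>\<not> 0 \<le> s\<close> N similarity_ifsD[OF ifs] by (intro sum_ratio_powr_strict_antimono) auto
  moreover have "(\<Sum>i=1..N. Lip (S i) powr 0) = real N"
    using similarity_ifsD(1)[OF ifs] by (simp add: order_less_imp_not_eq2)
  ultimately show False using s N unfolding is_similarity_dimension_def by simp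
qed

theorem theorem2p8:
  fixes S :: "nat \<Rightarrow> 'a::metric_space \<Rightarrow> 'a"
    and N :: nat and s :: real and C F0 FC :: "'a set"
  assumes "compact (UNIV :: 'a set)"
    and "similarity_ifs N S"
    and "is_similarity_dimension N S s"
    and "C \<noteq> {}" and "compact C"
    and "max (ereal s) (lower_box_dim C) < upper_box_dim C"
    and "is_attractor N S {} F0"
    and "is_attractor N S C FC"
  shows "(\<forall>t::real. ereal t > max (ereal s) (lower_box_dim C) \<longrightarrow>
            lower_box_dim FC \<le> max (ereal t) (ereal s + cov_reg_exp t C * ereal t)) \<and>
         ((\<forall>t::real. ereal t > max (ereal s) (lower_box_dim C) \<longrightarrow> cov_reg_exp t C = 0) \<longrightarrow>
            lower_box_dim FC \<le> max (ereal s) (lower_box_dim C) \<and>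
            (SOSC N S F0 \<longrightarrow>
               lower_box_dim FC = max (lower_box_dim F0) (lower_box_dim C)))"
proof -
  note X = assms(1) and ifs = assms(2) and FC = assms(8) and F0 = assms(7)
  let ?m = "max (ereal s) (lower_box_dim C)"
  have s: "0 \<le> s" using similarity_dimension_nonneg[OF ifs assms(3)] .
  have sum_s: "(\<Sum>i=1..N. Lip (S i) powr s) = 1"
    using assms(3) by (simp add: is_similarity_dimension_def)
  have mono: "(\<Sum>i=1..N. Lip (S i) powr b) < (\<Sum>i=1..N. Lip (S i) powr a)" if "a < b" for a b
    using that ifs similarity_ifsD[OF ifs]
    by (intro sum_ratio_powr_strict_antimono) (auto simp: similarity_ifs_def)
  have main: "lower_box_dim FC \<le> max (ereal t) (ereal s + cov_reg_exp t C * ereal t)"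
    if t: "?m < ereal t" for t
  proof (rule ccontr)
    have st: "s < t" and Ct: "lower_box_dim C < ereal t" using t by auto
    have t0: "0 < t" using st s by simp
    obtain p where p: "cov_reg_exp t C = ereal p" "0 \<le> p" "p \<le> 1"
      using cov_reg_exp_bounds[OF X assms(4), of t] by (cases "cov_reg_exp t C") auto
    assume "\<not> ?thesis"
    then have "ereal (max t (s + p * t)) < lower_box_dim FC"
      using p by (simp add: not_le)
    then obtain v where v: "max t (s + p * t) < v" "ereal v < lower_box_dim FC"
      using ereal_dense2[of "ereal (max t (s + p * t))" "lower_box_dim FC"] by auto
    \<comment> \<open>Chosen so that $(s + e) + (p + e) t = v$.\<close>
    define e where "e = (v - (s + p * t)) / (1 + t)"
    have e: "0 < e" "(1 + t) * e = v - (s + p * t)" using v(1) t0 by (auto simp: e_def)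
    define q where "q = min 1 (p + e)"
    have q: "0 \<le> q" "q \<le> 1" "cov_reg_exp t C < ereal q \<or> q = 1"
      using p e by (auto simp: q_def)
    have "lower_box_dim FC \<le> ereal (max t (s + e + q * t))"
      using s t0 e(1) q mono[of s t] mono[of s "s + e"] sum_s st
      by (intro lower_box_dim_attractor_le[OF X ifs FC]
          frequently_regular_scale_range[OF X assms(4) Ct]) auto
    also have "\<dots> \<le> ereal v"
    proof -
      have "q * t \<le> (p + e) * t" using t0 by (intro mult_right_mono) (auto simp: q_def)
      then show ?thesis using v(1) e(2) by (simp add: algebra_simps)
    qed
    finally show False using v(2) by simp
  qed
  have upper: "lower_box_dim FC \<le> ?m"
    if zero: "\<forall>t::real. ereal t > ?m \<longrightarrow> cov_reg_exp t C = 0"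
  proof (rule ccontr)
    assume "\<not> ?thesis"
    then obtain t where t: "?m < ereal t" "ereal t < lower_box_dim FC"
      using ereal_dense2[of ?m "lower_box_dim FC"] by (auto simp: not_le)
    have "lower_box_dim FC \<le> max (ereal t) (ereal s)" using main[OF t(1)] zero t(1) by simp
    also have "\<dots> = ereal t" using t(1) by (intro max_absorb1) (auto intro: less_imp_le)
    finally show False using t(2) by simp
  qed
  have F0_le: "lower_box_dim F0 \<le> lower_box_dim FC"
    using F0 homogeneous_attractor_subset[OF ifs F0 FC]
    by (intro lower_box_dim_mono[OF X]) (auto simp: is_attractor_def)
  have C_le: "lower_box_dim C \<le> lower_box_dim FC"
    using assms(4) FC by (intro lower_box_dim_mono[OF X]) (auto simp: is_attractor_def)
  have s_le: "ereal s \<le> lower_box_dim F0" if "SOSC N S F0"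
  proof (rule ccontr)
    assume "\<not> ?thesis"
    then obtain \<sigma> where \<sigma>: "lower_box_dim F0 < ereal \<sigma>" "\<sigma> < s"
      using ereal_dense2[of "lower_box_dim F0" "ereal s"] by (auto simp: not_le)
    have "0 \<le> lower_box_dim F0"
    proof -
      have "eventually (\<lambda>\<delta>::real. 0 < \<delta> \<and> \<delta> < 1) (at_right 0)"
        unfolding eventually_at_right_field by (intro exI[of _ 1]) auto
      then show ?thesis unfolding lower_box_dim_def
      proof (intro Liminf_bounded, eventually_elim)
        case (elim \<delta>)
        then have "1 \<le> covering_number \<delta> F0"
          using covering_number_ge_1[OF X] F0 by (auto simp: is_attractor_def)
        then show ?case using elim by (simp add: divide_nonneg_nonpos divide_nonneg_neg)
      qed
    qed
    then have "0 < ereal \<sigma>" using \<sigma>(1) by (rule le_less_trans)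
    then have "0 \<le> \<sigma>" by simp
    then have "ereal \<sigma> \<le> lower_box_dim F0"
      using mono[OF \<sigma>(2)] sum_s by (intro SOSC_lower_box_dim_ge[OF X ifs F0 that]) auto
    then show False using \<sigma>(1) by simp
  qed
  show ?thesis
  proof (intro conjI allI impI)
    assume "\<forall>t::real. ereal t > ?m \<longrightarrow> cov_reg_exp t C = 0" and sosc: "SOSC N S F0"
    then have "lower_box_dim FC \<le> ?m" using upper by blast
    also have "\<dots> \<le> max (lower_box_dim F0) (lower_box_dim C)"
      using s_le[OF sosc] by (intro max.mono) auto
    finally show "lower_box_dim FC = max (lower_box_dim F0) (lower_box_dim C)"
      using F0_le C_le by (intro antisym) auto
  qed (use main upper in blast)+
qed

end
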